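(* Let $G\subsetneq\mathbb{R}^n$ be any domain, $x\in G$ and $0<t<1$. Then $$B_{j^*}\left(x,\frac{t}{1+t}\right)\subseteq B_s(x,t)\subseteq B_{j^*}(x,t),$$ where the latter inclusion is sharp for all possible choices of the domain $G$. Moreover, if $G$ is convex, the former inclusion can be replaced with $$B_{j^*}\left(x,\frac{t}{\min\{1+t,\sqrt{2}\}}\right)\subseteq B_s(x,t).$$
   Context: For a domain $G\subsetneq\mathbb{R}^n$ and $x\in G$, $d_G(x)=\inf\{|x-z| : z\in\partial G\}$. The triangular ratio metric is $s_G(x,y)=\dfrac{|x-y|}{\inf_{z\in\partial G}(|x-z|+|z-y|)}$ and the $j^*$-metric is $j^*_G(x,y)=\dfrac{|x-y|}{|x-y|+2\min\{d_G(x),d_G(y)\}}$, for $x,y\in G$. The corresponding balls are $B_s(x,r)=\{y\in G : s_G(x,y)<r\}$ and $B_{j^*}(x,r)=\{y\in G : j^*_G(x,y)<r\}$. "Sharp" means that the radius of the containing ball $B_{j^*}(x,\cdot)$ cannot be replaced by any smaller number (for any given $G$, $x$, $t$). *)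

theory Defs
  imports "HOL-Analysis.Analysis"
begin

definition domain :: "'a::euclidean_space set \<Rightarrow> bool" where
  "domain G \<longleftrightarrow> open G \<and> connected G \<and> G \<noteq> {}"

definition boundary_dist :: "'a::euclidean_space set \<Rightarrow> 'a \<Rightarrow> real" where
  "boundary_dist G x = infdist x (frontier G)"

text \<open>The triangular ratio metric, meant for \<open>x, y \<in> G\<close>. For a domain \<open>G \<noteq> UNIV\<close> the
  infimum is over a nonempty set bounded below, hence is a genuine infimum.\<close>
definition triangular_ratio :: "'a::euclidean_space set \<Rightarrow> 'a \<Rightarrow> 'a \<Rightarrow> real" where
  "triangular_ratio G x y = dist x y / (INF z\<in>frontier G. dist x z + dist z y)"

definition jstar :: "'a::euclidean_space set \<Rightarrow> 'a \<Rightarrow> 'a \<Rightarrow> real" where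
  "jstar G x y =
     dist x y / (dist x y + 2 * min (boundary_dist G x) (boundary_dist G y))"

definition triangular_ratio_ball :: "'a::euclidean_space set \<Rightarrow> 'a \<Rightarrow> real \<Rightarrow> 'a set" where
  "triangular_ratio_ball G x r = {y \<in> G. triangular_ratio G x y < r}"

definition jstar_ball :: "'a::euclidean_space set \<Rightarrow> 'a \<Rightarrow> real \<Rightarrow> 'a set" where
  "jstar_ball G x r = {y \<in> G. jstar G x y < r}"

end

theory Submission
  imports Defs
begin

text \<open>Write \<open>D = dist x y\<close>, let \<open>m\<close> be the smaller of the distances of \<open>x\<close> and \<open>y\<close> to the
  frontier, and let \<open>I\<close> be the infimum of \<open>dist x z + dist z y\<close> over frontier points \<open>z\<close>. The two
  functions are \<open>D / I\<close> and \<open>D / (D + 2 * m)\<close>, so everything rests on comparing \<open>I\<close> with \<open>D\<close> and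
  \<open>m\<close>.

  Walking from one of the points to its nearest frontier point, back, and on to the other point
  shows \<open>I \<le> D + 2 * m\<close>; this gives the second inclusion. Conversely both legs of any path through
  the frontier have length at least \<open>m\<close>, so \<open>I \<ge> 2 * m\<close>; since \<open>jstar G x y < t / (1 + t)\<close> says
  exactly \<open>D < t * (2 * m)\<close>, this gives the first inclusion.

  If \<open>y\<close> lies on the segment from \<open>x\<close> to a nearest frontier point, the upper bound for \<open>I\<close> is
  attained and the two functions agree. Along that segment they take every value in \<open>[0, 1)\<close>, hence no
  radius \<open>r < t\<close> can work.

  In a convex domain a frontier point \<open>z\<close> has a supporting hyperplane, and both points lie at least
  \<open>m\<close> away from it. Reflecting one of them in the hyperplane shows that a path from \<open>x\<close> to \<open>y\<close>
  through \<open>z\<close> has squared length at least \<open>D\<^sup>2 + 4 * m\<^sup>2\<close>, which is at least \<open>(D + 2 * m)\<^sup>2 / 2\<close>.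
  Therefore the triangular ratio is at most \<open>sqrt 2\<close> times \<open>jstar\<close>.\<close>

section \<open>Paths through the frontier\<close>

lemma frontier_nonempty:
  fixes G :: "'a::euclidean_space set"
  assumes "domain G" "G \<noteq> UNIV"
  shows "frontier G \<noteq> {}"
  using assms by (auto simp: domain_def frontier_eq_empty)

lemma boundary_dist_pos:
  fixes G :: "'a::euclidean_space set"
  assumes "domain G" "G \<noteq> UNIV" "x \<in> G"
  shows "0 < boundary_dist G x"
proof -
  have "x \<notin> frontier G"
    using assms by (auto simp: domain_def frontier_def interior_open)
  then show ?thesis
    unfolding boundary_dist_def
    using infdist_pos_not_in_closed[OF frontier_closed frontier_nonempty[OF assms(1,2)]]
    by blast
qed

lemma boundary_dist_le_dist:
  fixes G :: "'a::euclidean_space set"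
  assumes "z \<in> frontier G"
  shows "boundary_dist G x \<le> dist x z"
  unfolding boundary_dist_def by (rule infdist_le[OF assms])

lemma nearest_frontier_point:
  fixes G :: "'a::euclidean_space set"
  assumes "frontier G \<noteq> {}"
  obtains z where "z \<in> frontier G" "boundary_dist G x = dist x z"
  using infdist_attains_inf[OF frontier_closed assms, of x]
  unfolding boundary_dist_def by blast

lemma ball_boundary_dist_subset:
  fixes G :: "'a::euclidean_space set"
  assumes "x \<in> G"
  shows "ball x (boundary_dist G x) \<subseteq> G"
proof (rule ccontr)
  assume "\<not> ?thesis"
  then obtain y where y: "y \<in> ball x (boundary_dist G x)" "y \<notin> G"
    by blast
  have x: "x \<in> ball x (boundary_dist G x)"
    using y(1) by (metis centre_in_ball dist_not_less_zero mem_ball not_less order_le_less_trans)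
  have "ball x (boundary_dist G x) \<inter> frontier G \<noteq> {}"
    using connected_Int_frontier[OF connected_ball, of x "boundary_dist G x" G] assms x y
    by blast
  then show False
    using boundary_dist_le_dist[of _ G x] by (force simp: not_less)
qed

definition frontier_path_length :: "'a::euclidean_space set \<Rightarrow> 'a \<Rightarrow> 'a \<Rightarrow> real" where
  "frontier_path_length G x y = (INF z\<in>frontier G. dist x z + dist z y)"

lemma frontier_path_length_le:
  assumes "z \<in> frontier G"
  shows "frontier_path_length G x y \<le> dist x z + dist z y"
  unfolding frontier_path_length_def
  by (rule cINF_lower[OF _ assms], rule bdd_belowI[of _ 0]) auto

lemma frontier_path_length_ge:
  assumes "frontier G \<noteq> {}" "\<And>z. z \<in> frontier G \<Longrightarrow> c \<le> dist x z + dist z y"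
  shows "c \<le> frontier_path_length G x y"
  unfolding frontier_path_length_def using assms by (intro cINF_greatest) auto

lemma boundary_dist_add_le_frontier_path_length:
  assumes "frontier G \<noteq> {}"
  shows "boundary_dist G x + boundary_dist G y \<le> frontier_path_length G x y"
  by (rule frontier_path_length_ge[OF assms])
    (use boundary_dist_le_dist in \<open>metis add_mono dist_commute\<close>)

text \<open>The detour through the frontier point nearest to \<open>x\<close> and back costs twice the distance of
  \<open>x\<close> to the frontier, and likewise for \<open>y\<close>.\<close>

lemma frontier_path_length_le_detour:
  assumes "frontier G \<noteq> {}"
  shows "frontier_path_length G x y
    \<le> dist x y + 2 * min (boundary_dist G x) (boundary_dist G y)"
proof -
  obtain z where z: "z \<in> frontier G" "boundary_dist G x = dist x z"
    using nearest_frontier_point[OF assms] .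
  obtain w where w: "w \<in> frontier G" "boundary_dist G y = dist y w"
    using nearest_frontier_point[OF assms] .
  have "dist x z + dist z y \<le> dist x y + 2 * dist x z"
    using dist_triangle[of z y x] by (simp add: dist_commute)
  moreover have "dist x w + dist w y \<le> dist x y + 2 * dist y w"
    using dist_triangle[of x w y] by (simp add: dist_commute)
  ultimately show ?thesis
    using frontier_path_length_le[OF z(1), of x y] frontier_path_length_le[OF w(1), of x y] z(2) w(2)
    by linarith
qed

section \<open>Comparison in arbitrary domains\<close>

lemma jstar_le_triangular_ratio:
  assumes "domain G" "G \<noteq> UNIV" "x \<in> G" "y \<in> G"
  shows "jstar G x y \<le> triangular_ratio G x y"
proof -
  have "0 < frontier_path_length G x y"
    using boundary_dist_add_le_frontier_path_length[OF frontier_nonempty, of G x y]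
      boundary_dist_pos[of G x] boundary_dist_pos[of G y] assms by linarith
  then show ?thesis
    using frontier_path_length_le_detour[OF frontier_nonempty, of G x y] assms
    by (auto simp: jstar_def triangular_ratio_def simp flip: frontier_path_length_def
        intro!: divide_left_mono mult_pos_pos)
qed

lemma triangular_ratio_less_if_jstar_less:
  assumes "domain G" "G \<noteq> UNIV" "x \<in> G" "y \<in> G" "0 < t"
    and less: "jstar G x y < t / (1 + t)"
  shows "triangular_ratio G x y < t"
proof -
  define m where "m = min (boundary_dist G x) (boundary_dist G y)"
  have m: "0 < m" "2 * m \<le> frontier_path_length G x y"
    using boundary_dist_add_le_frontier_path_length[OF frontier_nonempty, of G x y]
      boundary_dist_pos[of G x] boundary_dist_pos[of G y] assms by (auto simp: m_def)
  have "0 < dist x y + 2 * m"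
    using m(1) by (simp add: add_nonneg_pos)
  then have "dist x y < t * (2 * m)"
    using less \<open>0 < t\<close> by (simp add: jstar_def field_simps flip: m_def)
  also have "\<dots> \<le> t * frontier_path_length G x y"
    using m(2) \<open>0 < t\<close> by simp
  finally show ?thesis
    using m by (simp add: triangular_ratio_def divide_less_eq flip: frontier_path_length_def)
qed

text \<open>Both functions take every value \<open>u \<in> [0, 1)\<close> at a common point: on the segment from \<open>x\<close> to a
  nearest frontier point at distance \<open>d\<close>, the point at distance \<open>s\<close> from \<open>x\<close> has distance \<open>d - s\<close> to
  the frontier, and both values there are \<open>s / (2 * d - s)\<close>.\<close>

lemma triangular_ratio_and_jstar_attain:
  assumes "domain G" "G \<noteq> UNIV" "x \<in> G" "0 \<le> u" "u < 1"
  obtains y where "y \<in> G" "triangular_ratio G x y = u" "jstar G x y = u"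
proof -
  define d where "d = boundary_dist G x"
  have ne: "frontier G \<noteq> {}" and d: "0 < d"
    using frontier_nonempty boundary_dist_pos assms by (auto simp: d_def)
  obtain z where z: "z \<in> frontier G" "dist x z = d"
    using nearest_frontier_point[OF ne, of x] unfolding d_def by metis
  \<comment> \<open>The solution of \<open>s / (2 * d - s) = u\<close> is \<open>s = k * d\<close> with this \<open>k\<close>.\<close>
  define k where "k = 2 * u / (1 + u)"
  have k: "0 \<le> k" "k < 1" "u * (2 - k) = k"
    using assms(4,5) by (auto simp: k_def field_simps)
  define y where "y = x + k *\<^sub>R (z - x)"
  have xy: "dist x y = k * d"
    using z(2) k by (simp add: y_def dist_norm norm_minus_commute)
  have "y - z = (1 - k) *\<^sub>R (x - z)"
    by (simp add: y_def algebra_simps)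
  then have yz: "dist y z = (1 - k) * d"
    using z(2) k by (simp add: dist_norm)
  have "k * d < d"
    using k(2) d by simp
  then have y: "y \<in> G"
    using ball_boundary_dist_subset[OF assms(3)] xy by (auto simp: d_def)
  have "d \<le> k * d + boundary_dist G y"
    using infdist_triangle[of x "frontier G" y] xy by (simp add: d_def boundary_dist_def)
  moreover have "boundary_dist G y \<le> (1 - k) * d"
    using boundary_dist_le_dist[OF z(1), of y] yz by simp
  ultimately have dy: "boundary_dist G y = (1 - k) * d"
    by (simp add: algebra_simps)
  have min: "min d (boundary_dist G y) = (1 - k) * d"
    using mult_left_le_one_le[of d "1 - k"] dy k d by simp
  have "(2 - k) * d \<le> frontier_path_length G x y"
    using boundary_dist_add_le_frontier_path_length[OF ne, of x y] dy
    by (simp add: d_def[symmetric] algebra_simps)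
  moreover have "frontier_path_length G x y \<le> (2 - k) * d"
    using frontier_path_length_le_detour[OF ne, of x y] min xy
    by (simp add: d_def[symmetric] algebra_simps)
  ultimately have "frontier_path_length G x y = (2 - k) * d"
    by simp
  moreover have ratio: "k * d / ((2 - k) * d) = u"
    using k d by (simp add: field_simps)
  ultimately have "triangular_ratio G x y = u"
    using xy by (simp add: triangular_ratio_def flip: frontier_path_length_def)
  moreover have "k * d + 2 * ((1 - k) * d) = (2 - k) * d"
    by (simp add: algebra_simps)
  then have "jstar G x y = u"
    using ratio xy min by (simp add: jstar_def flip: d_def)
  ultimately show thesis
    using that y by blast
qed

section \<open>Comparison in convex domains\<close>

text \<open>The left-hand side is the squared distance from \<open>a\<close> to the mirror image of \<open>b\<close> in the
  hyperplane orthogonal to \<open>u\<close>. The reflection preserves the norm of \<open>b\<close>, so the claim is the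
  triangle inequality, or equivalently Cauchy-Schwarz, for \<open>a\<close> and the mirror image.\<close>

lemma norm_add_norm_ge_reflection:
  fixes a b u :: "'a::real_inner"
  assumes "norm u = 1"
  shows "(norm (a - b))\<^sup>2 + 4 * ((a \<bullet> u) * (b \<bullet> u)) \<le> (norm a + norm b)\<^sup>2"
proof -
  define b' where "b' = b - (2 * (b \<bullet> u)) *\<^sub>R u"
  have u: "u \<bullet> u = 1"
    using assms by (simp add: dot_square_norm)
  have "b' \<bullet> b' = b \<bullet> b"
    using u by (simp add: b'_def inner_diff inner_commute algebra_simps)
  then have "norm b' = norm b"
    by (simp add: norm_eq_sqrt_inner)
  then have "- (a \<bullet> b') \<le> norm a * norm b"
    using Cauchy_Schwarz_ineq2[of a b'] by simp
  moreover have "a \<bullet> b' = a \<bullet> b - 2 * ((a \<bullet> u) * (b \<bullet> u))"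
    by (simp add: b'_def inner_diff)
  moreover have "(norm (a - b))\<^sup>2 = (norm a)\<^sup>2 + (norm b)\<^sup>2 - 2 * (a \<bullet> b)"
    by (simp add: power2_norm_eq_inner inner_diff inner_commute algebra_simps)
  moreover have "(norm a + norm b)\<^sup>2 = (norm a)\<^sup>2 + (norm b)\<^sup>2 + 2 * (norm a * norm b)"
    by (simp add: power2_sum)
  ultimately show ?thesis
    by linarith
qed

text \<open>Here \<open>u\<close> is the inner normal of a supporting hyperplane at \<open>z\<close>.\<close>

lemma supporting_normal:
  fixes G :: "'a::euclidean_space set"
  assumes "convex G" "open G" "z \<in> frontier G"
  obtains u where "norm u = 1" "\<And>w. w \<in> G \<Longrightarrow> boundary_dist G w \<le> (w - z) \<bullet> u"
proof -
  have "z \<notin> G"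
    using assms by (simp add: frontier_def interior_open)
  then have "0 \<notin> (\<lambda>w. w - z) ` G"
    by auto
  then obtain a where a: "a \<noteq> 0" "\<And>w. w \<in> G \<Longrightarrow> 0 \<le> a \<bullet> (w - z)"
    using separating_hyperplane_set_0[of "(\<lambda>w. w - z) ` G"] assms(1)
    by (auto simp: convex_translation_subtract_eq Ball_def)
  define u where "u = a /\<^sub>R norm a"
  have u: "norm u = 1"
    using a(1) by (simp add: u_def)
  have nonneg: "0 \<le> (w - z) \<bullet> u" if "w \<in> G" for w
    using a(2)[OF that] by (simp add: u_def inner_commute)
  have "boundary_dist G w \<le> (w - z) \<bullet> u" if w: "w \<in> G" for w
  proof (rule dense_le)
    \<comment> \<open>Moving from \<open>w\<close> towards the hyperplane by less than its distance to the frontier stays in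
      \<open>G\<close>, hence on the same side.\<close>
    fix s assume s: "s < boundary_dist G w"
    show "s \<le> (w - z) \<bullet> u"
    proof (cases "0 \<le> s")
      case True
      then have "w - s *\<^sub>R u \<in> ball w (boundary_dist G w)"
        using s u by (simp add: dist_norm)
      then have "0 \<le> (w - s *\<^sub>R u - z) \<bullet> u"
        using ball_boundary_dist_subset[OF w] nonneg by blast
      then show ?thesis
        using u by (simp add: inner_diff dot_square_norm algebra_simps)
    next
      case False
      then show ?thesis
        using nonneg[OF w] by linarith
    qed
  qed
  with u show thesis
    using that by blast
qed

lemma convex_frontier_path_length_ge:
  fixes G :: "'a::euclidean_space set"
  assumes "domain G" "G \<noteq> UNIV" "convex G" "x \<in> G" "y \<in> G"
  shows "dist x y + 2 * min (boundary_dist G x) (boundary_dist G y)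
    \<le> sqrt 2 * frontier_path_length G x y"
proof -
  define m where "m = min (boundary_dist G x) (boundary_dist G y)"
  have m: "0 < m"
    using boundary_dist_pos[of G x] boundary_dist_pos[of G y] assms by (simp add: m_def)
  have "(dist x y + 2 * m) / sqrt 2 \<le> frontier_path_length G x y"
  proof (rule frontier_path_length_ge[OF frontier_nonempty[OF assms(1,2)]])
    fix z assume z: "z \<in> frontier G"
    obtain u where u: "norm u = 1" "\<And>w. w \<in> G \<Longrightarrow> boundary_dist G w \<le> (w - z) \<bullet> u"
      using supporting_normal[OF assms(3) _ z] assms(1) by (auto simp: domain_def)
    have "m \<le> (x - z) \<bullet> u" "m \<le> (y - z) \<bullet> u"
      using u(2)[OF assms(4)] u(2)[OF assms(5)] by (auto simp: m_def)
    then have "m\<^sup>2 \<le> ((x - z) \<bullet> u) * ((y - z) \<bullet> u)"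
      using m by (simp add: power2_eq_square mult_mono)
    moreover have "(dist x y)\<^sup>2 + 4 * (((x - z) \<bullet> u) * ((y - z) \<bullet> u)) \<le> (dist x z + dist z y)\<^sup>2"
      using norm_add_norm_ge_reflection[OF u(1), of "x - z" "y - z"]
      by (simp add: dist_norm norm_minus_commute)
    moreover have "(dist x y + 2 * m)\<^sup>2 \<le> 2 * ((dist x y)\<^sup>2 + 4 * m\<^sup>2)"
      using sum_squares_bound[of "dist x y" "2 * m"] by (simp add: power2_sum power_mult_distrib)
    ultimately have "(dist x y + 2 * m)\<^sup>2 \<le> 2 * (dist x z + dist z y)\<^sup>2"
      by (smt (verit))
    then have "(dist x y + 2 * m)\<^sup>2 \<le> (sqrt 2 * (dist x z + dist z y))\<^sup>2"
      by (simp add: power_mult_distrib)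
    then have "dist x y + 2 * m \<le> sqrt 2 * (dist x z + dist z y)"
      by (rule power2_le_imp_le) simp
    then show "(dist x y + 2 * m) / sqrt 2 \<le> dist x z + dist z y"
      by (simp add: divide_le_eq mult.commute)
  qed
  then show ?thesis
    by (simp add: m_def divide_le_eq mult.commute)
qed

lemma convex_triangular_ratio_le_jstar:
  fixes G :: "'a::euclidean_space set"
  assumes "domain G" "G \<noteq> UNIV" "convex G" "x \<in> G" "y \<in> G"
  shows "triangular_ratio G x y \<le> sqrt 2 * jstar G x y"
proof -
  define q where "q = dist x y + 2 * min (boundary_dist G x) (boundary_dist G y)"
  have q: "0 < q"
    using boundary_dist_pos[of G x] boundary_dist_pos[of G y] assms
    by (simp add: q_def add_nonneg_pos)
  have I: "q \<le> sqrt 2 * frontier_path_length G x y"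
    using convex_frontier_path_length_ge[OF assms] by (simp add: q_def)
  have I_pos: "0 < sqrt 2 * frontier_path_length G x y"
    using q I by (rule order_less_le_trans)
  have "triangular_ratio G x y = sqrt 2 * (dist x y / (sqrt 2 * frontier_path_length G x y))"
    by (simp add: triangular_ratio_def flip: frontier_path_length_def)
  also have "\<dots> \<le> sqrt 2 * (dist x y / q)"
    using I mult_pos_pos[OF q I_pos]
    by (intro mult_left_mono divide_left_mono) (simp_all add: mult.commute)
  finally show ?thesis
    by (simp add: jstar_def q_def)
qed

section \<open>Inclusions of balls\<close>

theorem lemma4p9:
  fixes G :: "(real ^ 'n) set" and x :: "real ^ 'n" and t :: real
  assumes "domain G" and "G \<noteq> UNIV" and "x \<in> G" and "0 < t" and "t < 1"
  shows "jstar_ball G x (t / (1 + t)) \<subseteq> triangular_ratio_ball G x t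
    \<and> triangular_ratio_ball G x t \<subseteq> jstar_ball G x t
    \<and> (\<forall>r < t. \<not> triangular_ratio_ball G x t \<subseteq> jstar_ball G x r)
    \<and> (convex G \<longrightarrow>
         jstar_ball G x (t / min (1 + t) (sqrt 2)) \<subseteq> triangular_ratio_ball G x t)"
proof (intro conjI allI impI)
  show general: "jstar_ball G x (t / (1 + t)) \<subseteq> triangular_ratio_ball G x t"
    using triangular_ratio_less_if_jstar_less[OF assms(1-3) _ assms(4)]
    by (auto simp: jstar_ball_def triangular_ratio_ball_def)
  show "triangular_ratio_ball G x t \<subseteq> jstar_ball G x t"
    using jstar_le_triangular_ratio[OF assms(1-3)]
    by (auto simp: jstar_ball_def triangular_ratio_ball_def intro: order_le_less_trans)
  show "\<not> triangular_ratio_ball G x t \<subseteq> jstar_ball G x r" if "r < t" for r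
  proof -
    have "max r 0 < 1"
      using that assms(5) by simp
    then obtain y where "y \<in> G" "triangular_ratio G x y = max r 0" "jstar G x y = max r 0"
      using triangular_ratio_and_jstar_attain[OF assms(1-3), of "max r 0"] by auto
    then have "y \<in> triangular_ratio_ball G x t" "y \<notin> jstar_ball G x r"
      using that assms(4) by (auto simp: jstar_ball_def triangular_ratio_ball_def)
    then show ?thesis
      by blast
  qed
  show "jstar_ball G x (t / min (1 + t) (sqrt 2)) \<subseteq> triangular_ratio_ball G x t" if "convex G"
  proof (cases "1 + t \<le> sqrt 2")
    case True
    then show ?thesis
      using general by (simp add: min_def)
  next
    case False
    have "triangular_ratio G x y < t" if "y \<in> G" "jstar G x y < t / sqrt 2" for y
    proof -
      have "sqrt 2 * jstar G x y < t"
        using that(2) by (simp add: less_divide_eq mult.commute)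
      then show ?thesis
        using convex_triangular_ratio_le_jstar[OF assms(1,2) \<open>convex G\<close> assms(3) that(1)]
        by linarith
    qed
    with False show ?thesis
      by (auto simp: min_def jstar_ball_def triangular_ratio_ball_def)
  qed
qed

end
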